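(* Let $A\in\mathbb{R}^{N\times N}$, $b\in\mathbb{R}^N$, and let $W_m\in\mathbb{R}^{N\times m}$, $W_{m+1}\in\mathbb{R}^{N\times(m+1)}$ and $\overline H_m\in\mathbb{R}^{(m+1)\times m}$ be the matrices produced by $m$ steps of the Arnoldi algorithm applied to $A$ and $b$, so that $AW_m=W_{m+1}\overline H_m$. Let $\overline H_m=U^{(m)}\Sigma^{(m)}V^{(m)T}$ be the SVD of $\overline H_m$, with $U^{(m)}\in\mathbb{R}^{(m+1)\times(m+1)}$, $V^{(m)}\in\mathbb{R}^{m\times m}$ and $\Sigma^{(m)}\in\mathbb{R}^{(m+1)\times m}$. Let $\overline U_{m+1}=W_{m+1}U^{(m)}\in\mathbb{R}^{N\times(m+1)}$ and $\overline V_m=W_mV^{(m)}\in\mathbb{R}^{N\times m}$. Then $$\left\|A-\overline U_{m+1}\Sigma^{(m)}\overline V_m^T\right\|=\left\|A(I-W_mW_m^T)\right\|.$$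
   Context: The Arnoldi algorithm applied to $A$ and $b$ builds (in exact arithmetic) an orthonormal basis $w_1,\dots,w_m$ of the Krylov subspace $\mathcal{K}_m(A,b)=\mathrm{span}\{b,Ab,\dots,A^{m-1}b\}$, starting from $w_1=b/\|b\|$. With $W_m=[w_1,\dots,w_m]$ it satisfies $AW_m=W_mH_m+h_{m+1,m}w_{m+1}e_m^T$, where $H_m=(h_{i,j})\in\mathbb{R}^{m\times m}$ is upper Hessenberg and $e_m=(0,\dots,0,1)^T\in\mathbb{R}^m$; equivalently $AW_m=W_{m+1}\overline H_m$, where $W_{m+1}=[w_1,\dots,w_{m+1}]$ has orthonormal columns and $\overline H_m=\begin{bmatrix}H_m\\ h_{m+1,m}e_m^T\end{bmatrix}\in\mathbb{R}^{(m+1)\times m}$. It is assumed that the process has not terminated before producing $w_{m+1}$ (i.e. $h_{j+1,j}\ne0$ for $1\le j\le m$). The norm is the Euclidean (spectral) norm. *)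

theory Defs
  imports Complex_Main "Jordan_Normal_Form.Matrix"
begin

definition vec_norm :: "real vec \<Rightarrow> real" where
  "vec_norm v = sqrt (v \<bullet> v)"

(* The operator norm induced by the Euclidean norm.  The unit ball rather than the unit
   sphere is used so that the set is nonempty also for matrices without columns. *)
definition spectral_norm :: "real mat \<Rightarrow> real" where
  "spectral_norm A = Sup {vec_norm (A *\<^sub>v x) | x. x \<in> carrier_vec (dim_col A) \<and> vec_norm x \<le> 1}"

(* The library's orthogonal_mat only asks for pairwise orthogonal nonzero columns; this is
   orthogonality in the usual sense. *)
definition real_orthogonal_mat :: "nat \<Rightarrow> real mat \<Rightarrow> bool" where
  "real_orthogonal_mat n Q \<longleftrightarrow>
     Q \<in> carrier_mat n n \<and> transpose_mat Q * Q = 1\<^sub>m n \<and> Q * transpose_mat Q = 1\<^sub>m n"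

(* M = U S V^T with the singular values in nonincreasing order on the diagonal of the
   rectangular matrix S. *)
definition is_SVD :: "real mat \<Rightarrow> real mat \<Rightarrow> real mat \<Rightarrow> real mat \<Rightarrow> bool" where
  "is_SVD M U S V \<longleftrightarrow>
     real_orthogonal_mat (dim_row M) U \<and>
     real_orthogonal_mat (dim_col M) V \<and>
     S \<in> carrier_mat (dim_row M) (dim_col M) \<and>
     diagonal_mat S \<and>
     (\<forall>i < min (dim_row M) (dim_col M). 0 \<le> S $$ (i, i)) \<and>
     (\<forall>i j. i \<le> j \<and> j < min (dim_row M) (dim_col M) \<longrightarrow> S $$ (j, j) \<le> S $$ (i, i)) \<and>
     M = U * S * transpose_mat V"

(* u minus the sum of (v . u) v over the list of vectors vs: one Gram-Schmidt sweep. *)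
definition gs_residual :: "real vec list \<Rightarrow> real vec \<Rightarrow> real vec" where
  "gs_residual vs u = u - vec (dim_vec u) (\<lambda>k. \<Sum>v\<leftarrow>vs. (v \<bullet> u) * v $ k)"

(* Indices start at 0: arnoldi_vec A b j is w_(j+1), and arnoldi_coeff A b i j is h_(i+1,j+1).
   After a breakdown (zero residual) division by zero makes all further vectors zero. *)
fun arnoldi_vec :: "real mat \<Rightarrow> real vec \<Rightarrow> nat \<Rightarrow> real vec" where
  "arnoldi_vec A b 0 = (1 / vec_norm b) \<cdot>\<^sub>v b"
| "arnoldi_vec A b (Suc j) =
     (let r = gs_residual (map (arnoldi_vec A b) [0..<Suc j]) (A *\<^sub>v arnoldi_vec A b j)
      in (1 / vec_norm r) \<cdot>\<^sub>v r)"

definition arnoldi_coeff :: "real mat \<Rightarrow> real vec \<Rightarrow> nat \<Rightarrow> nat \<Rightarrow> real" where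
  "arnoldi_coeff A b i j =
     (let u = A *\<^sub>v arnoldi_vec A b j in
      if i \<le> j then arnoldi_vec A b i \<bullet> u
      else if i = Suc j then vec_norm (gs_residual (map (arnoldi_vec A b) [0..<Suc j]) u)
      else 0)"

definition arnoldi_basis :: "real mat \<Rightarrow> real vec \<Rightarrow> nat \<Rightarrow> real mat" where
  "arnoldi_basis A b k = mat_of_cols (dim_vec b) (map (arnoldi_vec A b) [0..<k])"

definition arnoldi_hessenberg :: "real mat \<Rightarrow> real vec \<Rightarrow> nat \<Rightarrow> real mat" where
  "arnoldi_hessenberg A b m = mat (m + 1) m (\<lambda>(i, j). arnoldi_coeff A b i j)"

end

theory Submission
  imports Defs
begin

text \<open>The two matrices under the norm coincide: after inserting the SVD,
  \<open>Ubar * S * Vbar\<^sup>T = W\<^sub>m\<^sub>+\<^sub>1 * H * W\<^sub>m\<^sup>T\<close>, and the Arnoldi relation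
  \<open>A * W\<^sub>m = W\<^sub>m\<^sub>+\<^sub>1 * H\<close> turns this into \<open>A * W\<^sub>m * W\<^sub>m\<^sup>T\<close>.
  Column \<open>j\<close> of that relation is the Gram-Schmidt step solved for \<open>A w\<^sub>j\<close>.\<close>

lemma dim_gs_residual [simp]: "dim_vec (gs_residual vs u) = dim_vec u"
  by (simp add: gs_residual_def)

lemma gs_residual_index:
  "k < dim_vec u \<Longrightarrow> gs_residual vs u $ k = u $ k - (\<Sum>v\<leftarrow>vs. (v \<bullet> u) * v $ k)"
  by (simp add: gs_residual_def)

lemma arnoldi_vec_carrier:
  assumes "A \<in> carrier_mat N N" and "b \<in> carrier_vec N"
  shows "arnoldi_vec A b j \<in> carrier_vec N"
proof (cases j)
  case 0
  then show ?thesis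
    using assms by simp
next
  case (Suc i)
  \<comment> \<open>No induction on \<open>j\<close>: a product with \<open>A\<close> has
    \<open>dim_row A\<close> entries whatever the vector, and neither \<open>gs_residual\<close> nor
    scaling changes the length.\<close>
  have "dim_vec (arnoldi_vec A b (Suc i)) = dim_row A"
    unfolding arnoldi_vec.simps(2) Let_def by (simp del: upt_Suc arnoldi_vec.simps)
  then show ?thesis
    unfolding Suc using assms(1) by (intro carrier_vecI) (simp del: arnoldi_vec.simps)
qed

lemma arnoldi_basis_carrier:
  "b \<in> carrier_vec N \<Longrightarrow> arnoldi_basis A b k \<in> carrier_mat N k"
  by (auto simp: arnoldi_basis_def)

lemma arnoldi_hessenberg_carrier: "arnoldi_hessenberg A b m \<in> carrier_mat (m + 1) m"
  by (simp add: arnoldi_hessenberg_def)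

lemma arnoldi_basis_index:
  assumes "b \<in> carrier_vec N" and "k < N" and "j < n"
  shows "arnoldi_basis A b n $$ (k, j) = arnoldi_vec A b j $ k"
  using assms by (simp add: arnoldi_basis_def mat_of_cols_index del: upt_Suc)

lemma arnoldi_basis_col:
  assumes "A \<in> carrier_mat N N" and "b \<in> carrier_vec N" and "j < n"
  shows "col (arnoldi_basis A b n) j = arnoldi_vec A b j"
  using assms arnoldi_vec_carrier[OF assms(1,2), of j]
  by (simp add: arnoldi_basis_def del: upt_Suc)

text \<open>The subdiagonal coefficient is the norm of the residual. As it is nonzero, the
  normalisation can be undone, and moving the projections to the other side expresses
  \<open>A\<close> times the basis vector in the basis vectors up to index
  \<open>Suc j\<close>.\<close>

lemma arnoldi_step:
  assumes A: "A \<in> carrier_mat N N" and b: "b \<in> carrier_vec N" and k: "k < N"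
    and nz: "arnoldi_coeff A b (Suc j) j \<noteq> 0"
  shows "(A *\<^sub>v arnoldi_vec A b j) $ k =
    (\<Sum>i\<le>Suc j. arnoldi_vec A b i $ k * arnoldi_coeff A b i j)"
proof -
  define u where "u = A *\<^sub>v arnoldi_vec A b j"
  define r where "r = gs_residual (map (arnoldi_vec A b) [0..<Suc j]) u"
  have dim: "dim_vec u = N"
    using A by (simp add: u_def)
  have coeff: "arnoldi_coeff A b (Suc j) j = vec_norm r"
    by (simp add: arnoldi_coeff_def u_def r_def del: upt_Suc)
  have "arnoldi_vec A b (Suc j) = (1 / vec_norm r) \<cdot>\<^sub>v r"
    by (simp add: Let_def u_def r_def del: upt_Suc)
  \<comment> \<open>By \<open>nz\<close> and \<open>coeff\<close> the divisor
    \<open>vec_norm r\<close> is nonzero, so the default value of division by zero does not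
    occur.\<close>
  then have "arnoldi_vec A b (Suc j) $ k * vec_norm r = r $ k"
    using nz coeff k dim by (simp add: r_def del: upt_Suc)
  moreover have "r $ k = u $ k - (\<Sum>i\<le>j. (arnoldi_vec A b i \<bullet> u) * arnoldi_vec A b i $ k)"
    using k dim
    by (simp add: r_def gs_residual_index sum_list_distinct_conv_sum_set o_def
        atLeast0LessThan lessThan_Suc_atMost del: upt_Suc)
  moreover have "(\<Sum>i\<le>j. arnoldi_vec A b i $ k * arnoldi_coeff A b i j) =
      (\<Sum>i\<le>j. (arnoldi_vec A b i \<bullet> u) * arnoldi_vec A b i $ k)"
    by (intro sum.cong) (auto simp: arnoldi_coeff_def u_def)
  \<comment> \<open>The top term of the sum over \<open>{..Suc j}\<close> is \<open>r $ k\<close>;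
    the remaining terms are exactly what was subtracted from \<open>u $ k\<close> to form
    it.\<close>
  ultimately show ?thesis
    by (simp add: coeff u_def del: arnoldi_vec.simps)
qed

text \<open>Entry \<open>(k, j)\<close> is coordinate \<open>k\<close> of
  \<open>arnoldi_step\<close>, once its sum is extended to all \<open>m + 1\<close> columns by the
  Hessenberg zeros.\<close>

lemma arnoldi_relation:
  assumes A: "A \<in> carrier_mat N N" and b: "b \<in> carrier_vec N"
    and nz: "\<And>j. j < m \<Longrightarrow> arnoldi_coeff A b (Suc j) j \<noteq> 0"
  shows "A * arnoldi_basis A b m = arnoldi_basis A b (m + 1) * arnoldi_hessenberg A b m"
proof (rule eq_matI)
  note car = arnoldi_basis_carrier[OF b, of A] arnoldi_hessenberg_carrier[of A b m]
  fix k j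
  assume "k < dim_row (arnoldi_basis A b (m + 1) * arnoldi_hessenberg A b m)"
    and "j < dim_col (arnoldi_basis A b (m + 1) * arnoldi_hessenberg A b m)"
  then have k: "k < N" and j: "j < m"
    using car(1)[of "m + 1"] car(2) by auto
  have "(A * arnoldi_basis A b m) $$ (k, j) = (A *\<^sub>v arnoldi_vec A b j) $ k"
    using A car(1)[of m] k j arnoldi_basis_col[OF A b j] by simp
  also have "\<dots> = (\<Sum>i\<le>Suc j. arnoldi_vec A b i $ k * arnoldi_coeff A b i j)"
    using arnoldi_step[OF A b k nz[OF j]] .
  \<comment> \<open>From \<open>j < m\<close> the indices up to \<open>Suc j\<close> stay below
    \<open>m + 1\<close>; every added index exceeds \<open>Suc j\<close>, where the coefficient is 0
    by definition.\<close>
  also have "\<dots> = (\<Sum>i<m + 1. arnoldi_vec A b i $ k * arnoldi_coeff A b i j)"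
    using j by (intro sum.mono_neutral_left) (auto simp: arnoldi_coeff_def)
  also have "\<dots> = (arnoldi_basis A b (m + 1) * arnoldi_hessenberg A b m) $$ (k, j)"
    using car(1)[of "m + 1"] car(2) k j b
    by (auto simp: scalar_prod_def atLeast0LessThan arnoldi_basis_index
        arnoldi_hessenberg_def intro!: sum.cong)
  finally show "(A * arnoldi_basis A b m) $$ (k, j) =
    (arnoldi_basis A b (m + 1) * arnoldi_hessenberg A b m) $$ (k, j)" .
next
  show "dim_row (A * arnoldi_basis A b m) =
      dim_row (arnoldi_basis A b (m + 1) * arnoldi_hessenberg A b m)"
    using A carrier_matD(1)[OF arnoldi_basis_carrier[OF b]] by simp
next
  show "dim_col (A * arnoldi_basis A b m) =
      dim_col (arnoldi_basis A b (m + 1) * arnoldi_hessenberg A b m)"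
    using carrier_matD(2)[OF arnoldi_basis_carrier[OF b]]
      carrier_matD(2)[OF arnoldi_hessenberg_carrier] by simp
qed

theorem proposition6:
  fixes A U S V Ubar Vbar :: "real mat" and b :: "real vec" and N m :: nat
  assumes "A \<in> carrier_mat N N"
    and "b \<in> carrier_vec N"
    and "b \<noteq> 0\<^sub>v N"
    and "1 \<le> m"
    and "\<And>j. j < m \<Longrightarrow> arnoldi_coeff A b (j + 1) j \<noteq> 0"
    and "is_SVD (arnoldi_hessenberg A b m) U S V"
    and "Ubar = arnoldi_basis A b (m + 1) * U"
    and "Vbar = arnoldi_basis A b m * V"
  shows "spectral_norm (A - Ubar * S * transpose_mat Vbar) =
    spectral_norm (A * (1\<^sub>m N - arnoldi_basis A b m * transpose_mat (arnoldi_basis A b m)))"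
proof -
  let ?W = "arnoldi_basis A b m" and ?W' = "arnoldi_basis A b (m + 1)"
    and ?H = "arnoldi_hessenberg A b m"
  note A = assms(1) and b = assms(2)
  note W = arnoldi_basis_carrier[OF b, of A m] and W' = arnoldi_basis_carrier[OF b, of A "m + 1"]
  have dims: "dim_row ?H = m + 1" "dim_col ?H = m"
    using arnoldi_hessenberg_carrier[of A b m] by (rule carrier_matD)+
  have U: "U \<in> carrier_mat (m + 1) (m + 1)" and V: "V \<in> carrier_mat m m"
    and S: "S \<in> carrier_mat (m + 1) m" and H: "?H = U * S * transpose_mat V"
    using assms(6) unfolding is_SVD_def real_orthogonal_mat_def dims by iprover+
  have VT: "transpose_mat V \<in> carrier_mat m m" and WT: "transpose_mat ?W \<in> carrier_mat m N"
    using V W by auto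
  have "Ubar * S * transpose_mat Vbar = ?W' * U * S * (transpose_mat V * transpose_mat ?W)"
    using transpose_mult[OF W V] assms(7,8) by simp
  \<comment> \<open>Reassociation brings \<open>U\<close>, \<open>S\<close> and the transpose of
    \<open>V\<close> together, so that \<open>H\<close> can fold them into the Hessenberg
    matrix.\<close>
  also have "\<dots> = ?W' * (U * S) * (transpose_mat V * transpose_mat ?W)"
    using assoc_mult_mat[OF W' U S] by simp
  also have "\<dots> = ?W' * (U * S) * transpose_mat V * transpose_mat ?W"
    using assoc_mult_mat[OF mult_carrier_mat[OF W' mult_carrier_mat[OF U S]] VT WT] by simp
  also have "\<dots> = ?W' * ?H * transpose_mat ?W"
    using assoc_mult_mat[OF W' mult_carrier_mat[OF U S] VT] H by simp
  also have "\<dots> = A * ?W * transpose_mat ?W"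
    using arnoldi_relation[OF A b, of m] assms(5) by simp
  also have "\<dots> = A * (?W * transpose_mat ?W)"
    using assoc_mult_mat[OF A W WT] .
  finally have "A - Ubar * S * transpose_mat Vbar = A - A * (?W * transpose_mat ?W)"
    by simp
  \<comment> \<open>Reading the first \<open>A\<close> as \<open>A\<close> times the identity lets
    it be factored out on the left.\<close>
  also have "\<dots> = A * (1\<^sub>m N - ?W * transpose_mat ?W)"
    using mult_minus_distrib_mat[OF A one_carrier_mat mult_carrier_mat[OF W WT]] A by simp
  finally show ?thesis
    by simp
qed

end
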